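(* Let $A\in\mathbb{R}^{n\times n}$ be symmetric with eigenvalues $0\le\lambda_1\le\cdots\le\lambda_n$, and let $X_0=\alpha I$ with a real number $\alpha$ satisfying $$|\alpha|\ \ge\ \left(\frac{\lambda_1+\lambda_n}{2}\right)^{1/2}>0.$$ Put $t_0\equiv\frac12\|X_0^{-1}A-X_0\|$. Then $X_0$ is invertible, commutes with $A$, and satisfies $\sigma_{\min}(X_0)\ge\|X_0^{-1}A-X_0\|=2t_0$; the sequence of iterates $\{X_k\}$ of the iteration $$X_{k+1}=\tfrac12\,(X_k+X_k^{-1}A),\quad k=0,1,2,\dots,$$ started with $X_0$ converges to the principal square root $A^{1/2}$ of $A$; and, with $$\gamma_0\equiv\sigma_{\min}^{1/2}(X_0)\,(\sigma_{\min}(X_0)-2t_0)^{1/2},\qquad \omega(t)\equiv\frac12\,\frac{t^2}{(t^2+\gamma_0^2)^{1/2}},\qquad \sigma(t)\equiv t-\gamma_0+(t^2+\gamma_0^2)^{1/2},$$ the error bound $$\|X_*-X_k\|\le\sigma(\omega^{(k)}(t_0)),$$ where $X_*=A^{1/2}$ is the limit of the iterates, is an equality in each step $k\ge0$.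
   Context: $\|\cdot\|$ denotes the spectral norm (operator 2-norm), $\sigma_{\min}(X)$ denotes the smallest singular value of $X$, and $I$ is the $n\times n$ identity matrix. $\omega^{(k)}$ denotes the $k$-th iterate of the function $\omega$: $\omega^{(0)}(t)=t$ and $\omega^{(k)}(t)=\omega(\omega^{(k-1)}(t))$ for $k\ge1$. For a symmetric positive semidefinite $A=Q\Lambda Q^T$ with $Q\in\mathbb{R}^{n\times n}$ orthogonal and $\Lambda=\mathrm{diag}(\lambda_1,\dots,\lambda_n)$, the principal square root is $A^{1/2}=Q\,\mathrm{diag}(\lambda_1^{1/2},\dots,\lambda_n^{1/2})\,Q^T$.
   Formalization: For α<0 the iterates converge to −A^{1/2}, not A^{1/2} (n=1, A=1, α=−1 gives X_k=−1), so the claim is proved as stated for α>0, and for α<0 with limit X_*=−A^{1/2} and the same equality in the error bound. *)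

theory Defs
  imports "HOL-Analysis.Analysis"
begin

definition diag_mat :: "('n \<Rightarrow> real) \<Rightarrow> real^'n^'n" where
  "diag_mat d = (\<chi> i j. if i = j then d i else 0)"

(* The norm of the type real^'n^'n is the Frobenius norm; the spectral norm is the
   operator norm induced by the Euclidean norm of real^'n. *)
definition spectral_norm :: "real^'n^'n \<Rightarrow> real" where
  "spectral_norm M = onorm (\<lambda>v. M *v v)"

definition spectrum :: "real^'n^'n \<Rightarrow> real set" where
  "spectrum M = {c. \<exists>v. v \<noteq> 0 \<and> M *v v = c *\<^sub>R v}"

(* The singular values of M are the square roots of the eigenvalues of M^T M, a finite
   nonempty set of nonnegative reals. *)
definition sigma_min :: "real^'n^'n \<Rightarrow> real" where
  "sigma_min M = Min (sqrt ` spectrum (transpose M ** M))"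

(* l 1, ..., l n (n = CARD('n)) are the eigenvalues of M with algebraic multiplicity, in
   nondecreasing order; in particular all roots of the characteristic polynomial are real. *)
definition sorted_eigenvalues :: "real^'n^'n \<Rightarrow> (nat \<Rightarrow> real) \<Rightarrow> bool" where
  "sorted_eigenvalues M l \<longleftrightarrow>
     (\<forall>x. det (mat x - M) = (\<Prod>i = 1..CARD('n). x - l i)) \<and> mono_on {1..CARD('n)} l"

definition is_principal_sqrt :: "real^'n^'n \<Rightarrow> real^'n^'n \<Rightarrow> bool" where
  "is_principal_sqrt A S \<longleftrightarrow>
     (\<exists>Q d. orthogonal_matrix Q \<and> (\<forall>i. 0 \<le> d i) \<and>
        A = Q ** diag_mat d ** transpose Q \<and>
        S = Q ** diag_mat (\<lambda>i. sqrt (d i)) ** transpose Q)"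

lemma diag_mat_mult_nth:
  "(diag_mat d ** M) $ i $ j = d i * M $ i $ j"
  "(M ** diag_mat d) $ i $ j = M $ i $ j * d j"
  by (simp_all add: diag_mat_def matrix_matrix_mult_def if_distrib if_distribR cong: if_cong)

(* S does not depend on the chosen spectral decomposition of A. *)
lemma is_principal_sqrt_unique:
  assumes "is_principal_sqrt A S" "is_principal_sqrt A T"
  shows "S = T"
proof -
  obtain Q d where Q: "orthogonal_matrix Q" "\<And>i. 0 \<le> d i"
    "A = Q ** diag_mat d ** transpose Q" "S = Q ** diag_mat (\<lambda>i. sqrt (d i)) ** transpose Q"
    using assms(1) unfolding is_principal_sqrt_def by blast
  obtain P e where P: "orthogonal_matrix P" "\<And>i. 0 \<le> e i"
    "A = P ** diag_mat e ** transpose P" "T = P ** diag_mat (\<lambda>i. sqrt (e i)) ** transpose P"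
    using assms(2) unfolding is_principal_sqrt_def by blast
  have q: "transpose Q ** Q = mat 1" "Q ** transpose Q = mat 1"
    and p: "transpose P ** P = mat 1" "P ** transpose P = mat 1"
    using Q(1) P(1) by (auto simp: orthogonal_matrix_def)
  define B where "B = transpose P ** Q"
  have move: "P ** (transpose P ** Q ** D ** transpose Q) = Q ** D ** transpose Q" for D
    by (metis matrix_mul_assoc matrix_mul_lid p(2))
  have "B ** diag_mat d = transpose P ** A ** Q"
    unfolding B_def Q(3) by (metis matrix_mul_assoc matrix_mul_rid q(1))
  also have "\<dots> = diag_mat e ** B"
    unfolding B_def P(3) by (metis matrix_mul_assoc matrix_mul_lid p(1))
  finally have "B $ i $ j * d j = e i * B $ i $ j" for i j
    by (metis diag_mat_mult_nth)
  then have "B $ i $ j = 0 \<or> d j = e i" for i j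
    by (metis mult.commute mult_cancel_left)
  then have "B $ i $ j * sqrt (d j) = sqrt (e i) * B $ i $ j" for i j
    by (metis mult.commute mult_zero_left)
  then have *: "B ** diag_mat (\<lambda>i. sqrt (d i)) = diag_mat (\<lambda>i. sqrt (e i)) ** B"
    by (simp add: vec_eq_iff diag_mat_mult_nth)
  have "S = P ** (B ** diag_mat (\<lambda>i. sqrt (d i)) ** transpose Q)"
    unfolding Q(4) B_def by (simp add: move)
  also have "\<dots> = P ** (diag_mat (\<lambda>i. sqrt (e i)) ** B ** transpose Q)"
    by (simp add: *)
  also have "\<dots> = T"
    unfolding P(4) B_def by (metis matrix_mul_assoc matrix_mul_rid q(2))
  finally show ?thesis .
qed

definition principal_sqrt :: "real^'n^'n \<Rightarrow> real^'n^'n" where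
  "principal_sqrt A = (THE S. is_principal_sqrt A S)"

primrec newton_iterate :: "real^'n^'n \<Rightarrow> real^'n^'n \<Rightarrow> nat \<Rightarrow> real^'n^'n" where
  "newton_iterate A X0 0 = X0"
| "newton_iterate A X0 (Suc k) =
     (1/2) *\<^sub>R (newton_iterate A X0 k + matrix_inv (newton_iterate A X0 k) ** A)"

definition omega_fun :: "real \<Rightarrow> real \<Rightarrow> real" where
  "omega_fun \<gamma> t = 1/2 * (t\<^sup>2 / sqrt (t\<^sup>2 + \<gamma>\<^sup>2))"

definition sigma_fun :: "real \<Rightarrow> real \<Rightarrow> real" where
  "sigma_fun \<gamma> t = t - \<gamma> + sqrt (t\<^sup>2 + \<gamma>\<^sup>2)"

end

theory Submission
  imports Defs
begin

text \<open>
  Let \<open>\<lambda>\<^sub>1 \<le> \<dots> \<le> \<lambda>\<^sub>n\<close> be the eigenvalues of \<open>A\<close>. The symmetric matrix \<open>A\<close> is orthogonally similar to a diagonal matrix, and since \<open>X0\<close> is a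
  scalar matrix, every iterate is diagonalized by the same orthogonal \<open>Q\<close>. The diagonal entries of
  the iterates are scalar Newton iterates \<open>x\<^sub>k(\<lambda>)\<close> for \<open>sqrt \<lambda>\<close>, one for each eigenvalue
  \<open>\<lambda>\<close> of \<open>A\<close>, started at \<open>a = \<bar>\<alpha>\<bar>\<close> and multiplied by the sign of \<open>\<alpha>\<close>; each of them converges.
  The spectral norm of the error is therefore the largest of the scalar errors
  \<open>\<bar>x\<^sub>k(\<lambda>) - sqrt \<lambda>\<bar>\<close>.

  The bound is attained because this maximum sits at the smallest eigenvalue \<open>\<lambda>\<^sub>1\<close> in every step.
  At the start this holds because \<open>a\<close> is at least the midpoint of \<open>sqrt \<lambda>\<^sub>1\<close> and \<open>sqrt \<lambda>\<^sub>n\<close>, which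
  follows from \<open>a\<^sup>2 \<ge> (\<lambda>\<^sub>1 + \<lambda>\<^sub>n) / 2\<close>. It is preserved because the error \<open>e\<close> at \<open>s = sqrt \<lambda>\<close> is
  replaced by \<open>e\<^sup>2 / (2 * (s + e))\<close>, which for \<open>e \<ge> 0\<close> increases with \<open>e\<close> and decreases with \<open>s\<close>;
  only the starting error can be negative, and in the first step the denominator is \<open>2 * a\<close> for every
  eigenvalue (\<open>newton_sqrt_error_mono\<close>).

  The hypothesis on \<open>a\<close> also gives \<open>2 * t0 = (a\<^sup>2 - \<lambda>\<^sub>1) / a\<close>, so that \<open>\<gamma> = sqrt \<lambda>\<^sub>1\<close>. The map
  \<open>x \<mapsto> (x - \<gamma>\<^sup>2 / x) / 2\<close> carries the Newton step for \<open>\<gamma>\<close> to \<open>omega_fun \<gamma>\<close>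
  (\<open>omega_fun_iterate_newton_sqrt\<close>), and \<open>sigma_fun \<gamma>\<close> takes the image of \<open>x\<close> to \<open>x - \<gamma>\<close>
  (\<open>sigma_fun_half_diff\<close>). Hence the right-hand side of the bound is exactly the scalar error at \<open>\<lambda>\<^sub>1\<close>.
\<close>

section \<open>Spectral theorem for real symmetric matrices\<close>

text \<open>
  A maximizer of the quadratic form \<open>v \<bullet> f v\<close> on the unit sphere of \<open>S\<close> is an eigenvector: otherwise
  moving it slightly in the direction of the residual \<open>f v - c *\<^sub>R v\<close> would increase the form.
\<close>

lemma self_adjoint_has_eigenvector:
  fixes f :: "'a::euclidean_space \<Rightarrow> 'a"
  assumes lin: "linear f" and adj: "\<And>x y. f x \<bullet> y = x \<bullet> f y"
    and S: "subspace S" "f ` S \<subseteq> S" "S \<noteq> {0}"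
  obtains v c where "v \<in> S" "norm v = 1" "f v = c *\<^sub>R v"
proof -
  obtain s where s: "s \<in> S" "s \<noteq> 0"
    using S(1,3) subspace_0 by blast
  have "compact (sphere 0 1 \<inter> S)"
    by (intro compact_Int_closed compact_sphere closed_subspace S)
  moreover have "(1 / norm s) *\<^sub>R s \<in> sphere 0 1 \<inter> S"
    using s S(1) by (simp add: subspace_scale)
  moreover have "continuous_on (sphere 0 1 \<inter> S) (\<lambda>v. v \<bullet> f v)"
    using lin unfolding linear_conv_bounded_linear
    by (intro continuous_on_inner continuous_on_id linear_continuous_on)
  ultimately obtain v where v: "v \<in> sphere 0 1 \<inter> S"
    and max: "\<And>y. y \<in> sphere 0 1 \<inter> S \<Longrightarrow> y \<bullet> f y \<le> v \<bullet> f v"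
    using continuous_attains_sup[of "sphere 0 1 \<inter> S" "\<lambda>v. v \<bullet> f v"] by blast
  define c where "c = v \<bullet> f v"
  have vv: "v \<bullet> v = 1" using v by (simp add: dot_square_norm)
  have form_le: "w \<bullet> f w \<le> c * (w \<bullet> w)" if w: "w \<in> S" for w
  proof (cases "w = 0")
    case False
    have "(1 / norm w) *\<^sub>R w \<in> sphere 0 1 \<inter> S"
      using w False S(1) by (simp add: subspace_scale)
    from max[OF this] have "(w \<bullet> f w) / (norm w)\<^sup>2 \<le> c"
      by (simp add: c_def linear_scale[OF lin] power2_eq_square)
    then show ?thesis
      using False by (simp add: dot_square_norm divide_simps)
  qed simp
  define u where "u = f v - c *\<^sub>R v"
  have uS: "u \<in> S"
    using v S by (auto simp: u_def intro!: subspace_diff subspace_scale)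
  have uv: "u \<bullet> v = 0"
    using vv by (simp add: u_def c_def algebra_simps inner_commute)
  have ufv: "u \<bullet> f v = u \<bullet> u"
    using uv by (simp add: u_def inner_diff_right)
  define K where "K = c * (u \<bullet> u) - u \<bullet> f u"
  \<comment> \<open>This is \<open>form_le\<close> at \<open>v + t *\<^sub>R u\<close>; the left side is linear in \<open>t\<close>, the right side quadratic.\<close>
  have perturb: "2 * t * (u \<bullet> u) \<le> t\<^sup>2 * K" for t
  proof -
    have "v + t *\<^sub>R u \<in> S" using v uS S(1) by (simp add: subspace_add subspace_scale)
    then have le: "(v + t *\<^sub>R u) \<bullet> f (v + t *\<^sub>R u) \<le> c * ((v + t *\<^sub>R u) \<bullet> (v + t *\<^sub>R u))"
      by (rule form_le)
    have form: "(v + t *\<^sub>R u) \<bullet> f (v + t *\<^sub>R u) = c + 2 * t * (u \<bullet> u) + t\<^sup>2 * (u \<bullet> f u)"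
    proof -
      have "v \<bullet> f u = u \<bullet> u" using adj[of v u] ufv by (simp add: inner_commute)
      then show ?thesis
        by (simp add: linear_add[OF lin] linear_scale[OF lin] inner_add_left inner_add_right
            ufv c_def power2_eq_square algebra_simps)
    qed
    have norm: "(v + t *\<^sub>R u) \<bullet> (v + t *\<^sub>R u) = 1 + t\<^sup>2 * (u \<bullet> u)"
      using uv inner_commute[of v u]
      by (simp add: inner_add_left inner_add_right vv power2_eq_square)
    show ?thesis using le unfolding form norm by (simp add: K_def algebra_simps)
  qed
  have "u = 0"
  proof (rule ccontr)
    assume "u \<noteq> 0"
    then have pos: "u \<bullet> u > 0" by simp
    define t where "t = (u \<bullet> u) / (\<bar>K\<bar> + 1)"
    have t: "t > 0" using pos by (simp add: t_def)
    have "t * K \<le> t * (\<bar>K\<bar> + 1)" using t by simp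
    also have "\<dots> = u \<bullet> u" by (simp add: t_def add_nonneg_eq_0_iff)
    finally have "t * (t * K) \<le> t * (u \<bullet> u)" using t by simp
    with perturb[of t] have "t * (u \<bullet> u) \<le> 0" by (simp add: power2_eq_square)
    then show False using t pos by (simp add: mult_le_0_iff)
  qed
  then show ?thesis
    using that[of v c] v by (simp add: u_def)
qed

text \<open>
  Induction on the dimension: the orthogonal complement in \<open>S\<close> of an eigenvector is again invariant.
  As \<open>card B = dim S\<close>, the orthonormal set \<open>B\<close> is a basis of \<open>S\<close>.
\<close>

lemma self_adjoint_orthonormal_eigenbasis:
  fixes f :: "'a::euclidean_space \<Rightarrow> 'a"
  assumes lin: "linear f" and adj: "\<And>x y. f x \<bullet> y = x \<bullet> f y"
    and S: "subspace S" "f ` S \<subseteq> S"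
  shows "\<exists>B. B \<subseteq> S \<and> finite B \<and> card B = dim S \<and> pairwise orthogonal B
             \<and> (\<forall>b\<in>B. norm b = 1 \<and> (\<exists>c. f b = c *\<^sub>R b))"
  using S
proof (induction "dim S" arbitrary: S)
  case 0
  then show ?case by (intro exI[of _ "{}"]) auto
next
  case (Suc m)
  then have "S \<noteq> {0}" by auto
  then obtain v c where v: "v \<in> S" "norm v = 1" "f v = c *\<^sub>R v"
    using self_adjoint_has_eigenvector[OF lin adj Suc.prems] by blast
  define T where "T = {y \<in> S. \<forall>x \<in> span {v}. orthogonal x y}"
  have T_iff: "y \<in> T \<longleftrightarrow> y \<in> S \<and> v \<bullet> y = 0" for y
    by (auto simp: T_def span_singleton orthogonal_def)
  have "v \<noteq> 0" using v(2) by auto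
  then have "dim (span {v}) = 1" by simp
  moreover have "span {v} \<subseteq> S" using v(1) Suc.prems(1) by (simp add: span_minimal)
  ultimately have "dim T + 1 = dim S"
    using dim_subspace_orthogonal_to_vectors[OF subspace_span Suc.prems(1), of "{v}"]
    by (simp add: T_def)
  then have dimT: "m = dim T" using Suc.hyps(2) by simp
  have subT: "subspace T"
    using Suc.prems(1) by (auto simp: subspace_def T_iff inner_add_right)
  have invT: "f ` T \<subseteq> T"
    proof
    fix y assume "y \<in> f ` T"
    then obtain x where x: "y = f x" "x \<in> S" "v \<bullet> x = 0" by (auto simp: T_iff)
    have "v \<bullet> f x = 0" using adj[of v x] v(3) x(3) by simp
    then show "y \<in> T" using x Suc.prems(2) by (auto simp: T_iff)
  qed
  obtain B where B: "B \<subseteq> T" "finite B" "card B = dim T" "pairwise orthogonal B"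
    "\<forall>b\<in>B. norm b = 1 \<and> (\<exists>c. f b = c *\<^sub>R b)"
    using Suc.hyps(1)[OF dimT subT invT] by blast
  have "v \<notin> B" using B(1) v(2) by (auto simp: T_iff dot_square_norm)
  moreover have "pairwise orthogonal (insert v B)"
    using B(1,4) by (intro pairwise_orthogonal_insert) (auto simp: T_iff orthogonal_def)
  ultimately show ?case
    using B v dimT Suc.hyps(2) by (intro exI[of _ "insert v B"]) (auto simp: T_iff)
qed

text \<open>
  The matrix \<open>Q\<close> times the diagonal matrix of \<open>f\<close> times the transpose of \<open>Q\<close>; for orthogonal \<open>Q\<close>, the
  matrix whose eigenvector in column \<open>i\<close> of \<open>Q\<close> has the eigenvalue \<open>f i\<close>.
\<close>

definition orth_conj :: "real^'n^'n \<Rightarrow> ('n \<Rightarrow> real) \<Rightarrow> real^'n^'n" where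
  "orth_conj Q f = Q ** diag_mat f ** transpose Q"

lemma orth_conj_nth: "orth_conj Q f $ i $ j = (\<Sum>k\<in>UNIV. Q $ i $ k * f k * Q $ j $ k)"
proof -
  have "orth_conj Q f $ i $ j = (\<Sum>k\<in>UNIV. (Q ** diag_mat f) $ i $ k * transpose Q $ k $ j)"
    unfolding orth_conj_def by (subst matrix_matrix_mult_def) simp
  then show ?thesis by (simp add: diag_mat_mult_nth transpose_def)
qed

theorem symmetric_matrix_diagonalizable:
  fixes A :: "real^'n^'n"
  assumes "transpose A = A"
  obtains Q d where "orthogonal_matrix Q" "A = orth_conj Q d"
proof -
  have adj: "(A *v x) \<bullet> y = x \<bullet> (A *v y)" for x y
    using dot_lmul_matrix[of x A y] transpose_matrix_vector[of A x] assms by simp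
  obtain B :: "(real^'n) set" where B: "finite B" "card B = CARD('n)" "pairwise orthogonal B"
    "\<forall>b\<in>B. norm b = 1 \<and> (\<exists>c. A *v b = c *\<^sub>R b)"
    using self_adjoint_orthonormal_eigenbasis[OF matrix_vector_mul_linear[of A] adj subspace_UNIV]
    by auto
  obtain h where h: "bij_betw h (UNIV :: 'n set) B"
    using B(1,2) finite_same_card_bij[of "UNIV :: 'n set" B] by auto
  have hB: "h j \<in> B" and hinj: "h i = h j \<longleftrightarrow> i = j" for i j
    using h by (auto simp: bij_betw_def inj_on_def)
  have "\<forall>j. \<exists>c. A *v h j = c *\<^sub>R h j"
    using B(4) hB by blast
  from choice[OF this] obtain d where d: "\<And>j. A *v h j = d j *\<^sub>R h j"
    by blast
  define Q :: "real^'n^'n" where "Q = (\<chi> i j. h j $ i)"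
  have col: "column j Q = h j" for j
    by (simp add: Q_def column_def vec_eq_iff)
  have Q: "orthogonal_matrix Q"
    unfolding orthogonal_matrix_orthonormal_columns col
    using B(3,4) hB hinj by (auto simp: pairwise_def)
  have "(A ** Q) $ i $ j = (Q ** diag_mat d) $ i $ j" for i j
  proof -
    have "(A ** Q) $ i $ j = (A *v h j) $ i"
      by (simp add: matrix_matrix_mult_def matrix_vector_mult_def Q_def)
    then show ?thesis by (simp add: d diag_mat_mult_nth Q_def)
  qed
  then have "A ** Q = Q ** diag_mat d" by (simp add: vec_eq_iff)
  then have "A = orth_conj Q d"
    unfolding orth_conj_def
    by (metis Q matrix_mul_assoc matrix_mul_rid orthogonal_matrix_def)
  with Q show ?thesis using that by blast
qed

section \<open>Functions of a diagonalized matrix\<close>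

lemma orth_conj_add: "orth_conj Q f + orth_conj Q g = orth_conj Q (\<lambda>i. f i + g i)"
  by (simp add: vec_eq_iff orth_conj_nth sum.distrib[symmetric] algebra_simps)

lemma orth_conj_diff: "orth_conj Q f - orth_conj Q g = orth_conj Q (\<lambda>i. f i - g i)"
  by (simp add: vec_eq_iff orth_conj_nth sum_subtractf[symmetric] algebra_simps)

lemma orth_conj_scaleR: "c *\<^sub>R orth_conj Q f = orth_conj Q (\<lambda>i. c * f i)"
  by (simp add: vec_eq_iff orth_conj_nth sum_distrib_left algebra_simps)

lemma diag_mat_mult: "diag_mat f ** diag_mat g = diag_mat (\<lambda>i. f i * g i)"
  by (simp add: vec_eq_iff diag_mat_mult_nth) (simp add: diag_mat_def)

lemma diag_mat_const: "diag_mat (\<lambda>i. c) = mat c"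
  by (simp add: vec_eq_iff diag_mat_def mat_def)

lemma orth_conj_mult:
  assumes "orthogonal_matrix Q"
  shows "orth_conj Q f ** orth_conj Q g = orth_conj Q (\<lambda>i. f i * g i)"
proof -
  have "orth_conj Q f ** orth_conj Q g
      = Q ** diag_mat f ** (transpose Q ** Q) ** diag_mat g ** transpose Q"
    by (simp add: orth_conj_def matrix_mul_assoc)
  also have "\<dots> = Q ** (diag_mat f ** diag_mat g) ** transpose Q"
    using assms by (simp add: orthogonal_matrix_def matrix_mul_assoc)
  finally show ?thesis by (simp add: orth_conj_def diag_mat_mult)
qed

lemma orth_conj_one:
  assumes "orthogonal_matrix Q"
  shows "orth_conj Q (\<lambda>i. 1) = mat 1"
  using assms by (simp add: orth_conj_def diag_mat_const orthogonal_matrix_def)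

lemma orth_conj_const:
  assumes "orthogonal_matrix Q"
  shows "orth_conj Q (\<lambda>i. c) = c *\<^sub>R mat 1"
  using orth_conj_scaleR[of c Q "\<lambda>i. 1"] orth_conj_one[OF assms] by simp

lemma
  assumes Q: "orthogonal_matrix Q" and f: "\<And>i. f i \<noteq> 0"
  shows invertible_orth_conj: "invertible (orth_conj Q f)"
    and matrix_inv_orth_conj: "matrix_inv (orth_conj Q f) = orth_conj Q (\<lambda>i. 1 / f i)"
proof -
  have *: "orth_conj Q f ** orth_conj Q (\<lambda>i. 1 / f i) = mat 1"
       "orth_conj Q (\<lambda>i. 1 / f i) ** orth_conj Q f = mat 1"
    using f by (simp_all add: orth_conj_mult[OF Q] orth_conj_one[OF Q])
  then show inv: "invertible (orth_conj Q f)" unfolding invertible_def by blast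
  show "matrix_inv (orth_conj Q f) = orth_conj Q (\<lambda>i. 1 / f i)"
  proof -
    have "matrix_inv (orth_conj Q f) ** orth_conj Q f = mat 1"
      using someI_ex[OF inv[unfolded invertible_def]] by (simp add: matrix_inv_def)
    then show ?thesis by (metis *(1) matrix_mul_assoc matrix_mul_lid matrix_mul_rid)
  qed
qed

lemma tendsto_orth_conj:
  assumes "\<And>i. (\<lambda>k. f k i) \<longlonglongrightarrow> g i"
  shows "(\<lambda>k. orth_conj Q (f k)) \<longlonglongrightarrow> orth_conj Q g"
  by (intro vec_tendstoI) (auto simp: orth_conj_nth intro!: tendsto_intros assms)

lemma spectral_norm_orth_conj:
  assumes Q: "orthogonal_matrix Q" and le: "\<And>i. \<bar>f i\<bar> \<le> m" and att: "\<bar>f j\<bar> = m"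
  shows "spectral_norm (orth_conj Q f) = m"
proof -
  have iso: "norm (Q *v x) = norm x" "norm (transpose Q *v x) = norm x" for x
    using Q by (metis orthogonal_matrix_transpose orthogonal_transformation_matrix
        matrix_vector_mul_linear matrix_of_matrix_vector_mul orthogonal_transformation_norm)+
  have diag: "(diag_mat f *v x) $ i = f i * x $ i" for x i
    by (simp add: diag_mat_def matrix_vector_mult_def if_distrib if_distribR cong: if_cong)
  have norm_eq: "norm (orth_conj Q f *v x) = norm (diag_mat f *v (transpose Q *v x))" for x
    unfolding orth_conj_def matrix_vector_mul_assoc[symmetric] iso ..
  show ?thesis unfolding spectral_norm_def
  proof (rule antisym)
    show "onorm ((*v) (orth_conj Q f)) \<le> m"
    proof (rule onorm_le)
      fix x
      have "m \<ge> 0" using att by auto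
      then have "norm (diag_mat f *v y) \<le> norm (m *\<^sub>R y)" for y
        by (intro norm_le_componentwise_cart) (auto simp: diag abs_mult intro!: mult_right_mono le)
      then show "norm (orth_conj Q f *v x) \<le> m * norm x"
        unfolding norm_eq using \<open>m \<ge> 0\<close> iso(2)[of x]
        by (metis abs_of_nonneg norm_scaleR)
    qed
    have "transpose Q *v (Q *v axis j 1) = axis j 1"
      using Q by (metis matrix_vector_mul_assoc matrix_vector_mul_lid orthogonal_matrix_def)
    moreover have "diag_mat f *v axis j 1 = f j *\<^sub>R axis j 1"
      by (simp add: vec_eq_iff diag axis_def)
    ultimately have "norm (orth_conj Q f *v (Q *v axis j 1)) = m"
      unfolding norm_eq using att by (simp add: norm_axis_1)
    then show "m \<le> onorm ((*v) (orth_conj Q f))"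
      using onorm[OF matrix_vector_mul_bounded_linear, of "orth_conj Q f" "Q *v axis j 1"]
      by (simp add: iso norm_axis_1)
  qed
qed

lemma principal_sqrt_orth_conj:
  assumes "orthogonal_matrix Q" "\<And>i. 0 \<le> d i"
  shows "principal_sqrt (orth_conj Q d) = orth_conj Q (\<lambda>i. sqrt (d i))"
proof -
  have "is_principal_sqrt (orth_conj Q d) (orth_conj Q (\<lambda>i. sqrt (d i)))"
    unfolding is_principal_sqrt_def orth_conj_def using assms by blast
  then show ?thesis
    unfolding principal_sqrt_def using is_principal_sqrt_unique by blast
qed

lemma det_mat_minus_orth_conj:
  assumes Q: "orthogonal_matrix Q"
  shows "det (mat x - orth_conj Q d) = (\<Prod>i\<in>UNIV. x - d i)"
proof -
  have "mat x = orth_conj Q (\<lambda>i. x)"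
    using orth_conj_const[OF Q, of x] by (simp add: vec_eq_iff mat_def)
  then have "det (mat x - orth_conj Q d) = det Q * det (diag_mat (\<lambda>i. x - d i)) * det Q"
    by (simp add: orth_conj_diff) (simp add: orth_conj_def det_mul)
  moreover have "det (diag_mat (\<lambda>i. x - d i)) = (\<Prod>i\<in>UNIV. x - d i)"
    by (subst det_diagonal) (auto simp: diag_mat_def)
  moreover have "det Q * det Q = 1"
    using det_orthogonal_matrix[OF Q] by auto
  ultimately show ?thesis by (simp add: mult.commute mult.left_commute)
qed

text \<open>
  Both sides are the set of roots of the characteristic polynomial. Multiplicities are not compared.
\<close>

lemma range_eq_sorted_eigenvalues:
  fixes Q :: "real^'n^'n"
  assumes Q: "orthogonal_matrix Q" and "sorted_eigenvalues (orth_conj Q d) l"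
  shows "range d = l ` {1..CARD('n)}"
proof -
  have prod_eq: "(\<Prod>i\<in>UNIV. x - d i) = (\<Prod>i = 1..CARD('n). x - l i)" for x
    using assms(2) det_mat_minus_orth_conj[OF Q, of x d] by (simp add: sorted_eigenvalues_def)
  then have "(\<exists>i. x = d i) \<longleftrightarrow> (\<exists>i\<in>{1..CARD('n)}. x = l i)" for x
  proof -
    have "(\<exists>i. x = d i) \<longleftrightarrow> (\<Prod>i\<in>UNIV. x - d i) = 0" by (auto simp: prod_zero_iff)
    also have "\<dots> \<longleftrightarrow> (\<Prod>i = 1..CARD('n). x - l i) = 0" by (simp only: prod_eq)
    also have "\<dots> \<longleftrightarrow> (\<exists>i\<in>{1..CARD('n)}. x = l i)" by (subst prod_zero_iff) auto
    finally show ?thesis .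
  qed
  then show ?thesis by (auto simp: image_iff)
qed

lemma sigma_min_scaleR_mat1: "sigma_min (c *\<^sub>R mat 1 :: real^'n^'n) = \<bar>c\<bar>"
proof -
  have "transpose (c *\<^sub>R mat 1 :: real^'n^'n) ** (c *\<^sub>R mat 1) = c\<^sup>2 *\<^sub>R mat 1"
    by (simp add: transpose_scalar transpose_mat matrix_scalar_ac scalar_matrix_assoc[symmetric]
        power2_eq_square)
  moreover have "spectrum (c\<^sup>2 *\<^sub>R mat 1 :: real^'n^'n) = {c\<^sup>2}"
  proof -
    have "(\<exists>v :: real^'n. v \<noteq> 0 \<and> c\<^sup>2 *\<^sub>R v = e *\<^sub>R v) \<longleftrightarrow> e = c\<^sup>2" for e
      by (metis scaleR_right_imp_eq zero_neq_one vec_eq_iff one_index zero_index)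
    then show ?thesis
      by (simp add: spectrum_def scaleR_matrix_vector_assoc[symmetric])
  qed
  ultimately show ?thesis by (simp add: sigma_min_def)
qed

section \<open>The scalar Newton iteration for the square root\<close>

text \<open>The Newton iterates for \<open>sqrt b\<close> started at \<open>a\<close>.\<close>

primrec newton_sqrt :: "real \<Rightarrow> real \<Rightarrow> nat \<Rightarrow> real" where
  "newton_sqrt a b 0 = a"
| "newton_sqrt a b (Suc k) = (newton_sqrt a b k + b / newton_sqrt a b k) / 2"

lemma newton_sqrt_pos: "a > 0 \<Longrightarrow> b \<ge> 0 \<Longrightarrow> newton_sqrt a b k > 0"
  by (induction k) (auto intro: add_pos_nonneg)

lemma newton_sqrt_error_Suc:
  assumes "a > 0" "b \<ge> 0"
  shows "newton_sqrt a b (Suc k) - sqrt b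
      = (newton_sqrt a b k - sqrt b)\<^sup>2 / (2 * newton_sqrt a b k)"
proof -
  have "sqrt b * sqrt b = b" using assms(2) by simp
  then show ?thesis
    using newton_sqrt_pos[OF assms, of k] by (simp add: divide_simps power2_eq_square algebra_simps)
qed

lemma newton_sqrt_Suc_ge:
  assumes "a > 0" "b \<ge> 0"
  shows "sqrt b \<le> newton_sqrt a b (Suc k)"
proof -
  have "0 \<le> newton_sqrt a b (Suc k) - sqrt b"
    unfolding newton_sqrt_error_Suc[OF assms]
    using newton_sqrt_pos[OF assms, of k] by (intro divide_nonneg_nonneg) auto
  then show ?thesis by simp
qed

lemma newton_sqrt_tendsto:
  assumes "a > 0" "b \<ge> 0"
  shows "newton_sqrt a b \<longlonglongrightarrow> sqrt b"
proof -
  define e where "e k = newton_sqrt a b (Suc k) - sqrt b" for k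
  have e0: "e k \<ge> 0" for k using newton_sqrt_Suc_ge[OF assms] by (simp add: e_def)
  \<comment> \<open>After the first step \<open>0 \<le> e k \<le> newton_sqrt a b (Suc k)\<close>, so the error at least halves.\<close>
  have halve: "e (Suc k) \<le> e k / 2" for k
  proof -
    let ?x = "newton_sqrt a b (Suc k)"
    have x: "?x > 0" using newton_sqrt_pos[OF assms] .
    have "e (Suc k) = (e k)\<^sup>2 / (2 * ?x)"
      unfolding e_def using newton_sqrt_error_Suc[OF assms, of "Suc k"] .
    also have "\<dots> \<le> (e k * ?x) / (2 * ?x)"
      using x e0[of k] assms(2) unfolding power2_eq_square
      by (intro divide_right_mono mult_left_mono) (auto simp: e_def simp del: newton_sqrt.simps)
    also have "\<dots> = e k / 2" using x by (simp del: newton_sqrt.simps)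
    finally show ?thesis .
  qed
  have "e k \<le> e 0 * (1/2) ^ k" for k
  proof (induction k)
    case (Suc k)
    then show ?case using halve[of k] by simp
  qed simp
  then have upper: "\<forall>\<^sub>F k in sequentially. e k \<le> e 0 * (1/2) ^ k" by simp
  have "(\<lambda>k. e 0 * (1/2) ^ k) \<longlonglongrightarrow> 0"
    by (intro tendsto_mult_right_zero LIMSEQ_power_zero) simp
  from tendsto_sandwich[OF always_eventually upper tendsto_const this]
  have "e \<longlonglongrightarrow> 0" using e0 by simp
  then have "(\<lambda>k. newton_sqrt a b (Suc k)) \<longlonglongrightarrow> sqrt b"
    unfolding e_def by (rule LIM_zero_cancel)
  then show ?thesis by (rule LIMSEQ_imp_Suc)
qed

text \<open>
  If the absolute starting error at the larger radicand \<open>c\<close> does not exceed the one at \<open>b\<close>, the same is true of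
  all later errors. The starting error at \<open>c\<close> may be negative, so the first step differs from
  the others: there both iterates have the same denominator \<open>2 * a\<close>.
\<close>

lemma newton_sqrt_error_mono:
  assumes a: "a > 0" and bc: "0 \<le> b" "b \<le> c" and start: "\<bar>sqrt c - a\<bar> \<le> a - sqrt b"
  shows "\<bar>newton_sqrt a c k - sqrt c\<bar> \<le> newton_sqrt a b k - sqrt b"
proof (induction k)
  case 0
  then show ?case using start by (simp add: abs_minus_commute)
next
  case (Suc k)
  have c: "0 \<le> c" using bc by simp
  define x y where "x = newton_sqrt a c k" and "y = newton_sqrt a b k"
  define e where "e = y - sqrt b"
  have pos: "x > 0" "y > 0" using newton_sqrt_pos[OF a] bc c by (auto simp: x_def y_def)
  have IH: "\<bar>x - sqrt c\<bar> \<le> e" using Suc by (simp add: x_def y_def e_def)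
  have "newton_sqrt a c (Suc k) - sqrt c = (x - sqrt c)\<^sup>2 / (2 * x)"
    unfolding x_def by (rule newton_sqrt_error_Suc[OF a c])
  also have "\<dots> \<le> e\<^sup>2 / (2 * y)"
  proof (cases k)
    case 0
    then have "x = y" by (simp add: x_def y_def)
    moreover have "(x - sqrt c)\<^sup>2 \<le> e\<^sup>2" using IH by (metis abs_ge_zero power_mono power2_abs)
    ultimately show ?thesis using pos by (simp add: divide_right_mono)
  next
    case (Suc n)
    define s r g where "s = sqrt b" and "r = sqrt c" and "g = x - sqrt c"
    have g: "0 \<le> g" "g \<le> e"
      using IH newton_sqrt_Suc_ge[OF a c, of n] by (auto simp: g_def x_def Suc)
    have sr: "0 \<le> s" "s \<le> r" using bc by (auto simp: s_def r_def)
    have xy: "x = r + g" "y = s + e" by (auto simp: r_def g_def s_def e_def)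
    have "g * g * s \<le> e * e * r"
      by (intro mult_mono g sr order_trans[OF g(1,2)]) (use g sr in auto)
    moreover have "g * e * g \<le> g * e * e"
      using g by (intro mult_left_mono) auto
    ultimately have "g\<^sup>2 * y \<le> e\<^sup>2 * x"
      by (simp add: xy power2_eq_square algebra_simps)
    then show ?thesis
      using pos by (simp add: g_def[symmetric] divide_simps mult.commute)
  qed
  also have "\<dots> = newton_sqrt a b (Suc k) - sqrt b"
    unfolding e_def y_def by (rule newton_sqrt_error_Suc[OF a bc(1), symmetric])
  finally show ?case
    using newton_sqrt_Suc_ge[OF a c, of k] by simp
qed

text \<open>
  The substitution \<open>t = (x - g\<^sup>2 / x) / 2\<close> rationalizes \<open>sqrt (t\<^sup>2 + g\<^sup>2)\<close>, and the square root is the Newton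
  step for \<open>g\<close> at \<open>x\<close>. The case \<open>g = 0\<close>, of a singular matrix, is included.
\<close>

lemma
  fixes x g :: real
  assumes "x > 0"
  defines "t \<equiv> (x - g\<^sup>2 / x) / 2"
  shows sqrt_half_diff: "sqrt (t\<^sup>2 + g\<^sup>2) = (x + g\<^sup>2 / x) / 2"
    and sigma_fun_half_diff: "sigma_fun g t = x - g"
proof -
  have "t\<^sup>2 + g\<^sup>2 = ((x + g\<^sup>2 / x) / 2)\<^sup>2"
    using assms(1) by (simp add: t_def field_simps power2_eq_square)
  then show *: "sqrt (t\<^sup>2 + g\<^sup>2) = (x + g\<^sup>2 / x) / 2"
    using assms(1) by (simp add: real_sqrt_abs add_nonneg_nonneg)
  show "sigma_fun g t = x - g"
    unfolding sigma_fun_def * by (simp add: t_def field_simps)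
qed

lemma omega_fun_iterate_newton_sqrt:
  assumes "a > 0"
  shows "(omega_fun g ^^ k) ((a - g\<^sup>2 / a) / 2)
      = (newton_sqrt a (g\<^sup>2) k - g\<^sup>2 / newton_sqrt a (g\<^sup>2) k) / 2"
proof (induction k)
  case (Suc k)
  define x where "x = newton_sqrt a (g\<^sup>2) k"
  define y where "y = (x + g\<^sup>2 / x) / 2"
  have x: "x > 0" using newton_sqrt_pos[OF assms] by (simp add: x_def)
  then have y: "y > 0" by (simp add: y_def add_pos_nonneg)
  have sq: "((x - g\<^sup>2 / x) / 2)\<^sup>2 = y\<^sup>2 - g\<^sup>2"
    using x by (simp add: y_def field_simps power2_eq_square)
  have step: "omega_fun g ((x - g\<^sup>2 / x) / 2) = (y - g\<^sup>2 / y) / 2"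
    unfolding omega_fun_def sqrt_half_diff[OF x] y_def[symmetric] sq
    using y by (simp add: field_simps power2_eq_square)
  have "(omega_fun g ^^ k) ((a - g\<^sup>2 / a) / 2) = (x - g\<^sup>2 / x) / 2"
    using Suc by (simp add: x_def)
  with step show ?case
    by (simp only: funpow.simps o_apply newton_sqrt.simps x_def[symmetric] y_def[symmetric])
qed simp

section \<open>The matrix iteration\<close>

lemma newton_iterate_orth_conj:
  fixes Q :: "real^'n^'n"
  assumes Q: "orthogonal_matrix Q" and d: "\<And>i. 0 \<le> d i" and "\<alpha> \<noteq> 0"
  shows "newton_iterate (orth_conj Q d) (\<alpha> *\<^sub>R mat 1) k
      = orth_conj Q (\<lambda>i. sgn \<alpha> * newton_sqrt \<bar>\<alpha>\<bar> (d i) k)"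
proof (induction k)
  case 0
  then show ?case by (simp add: orth_conj_const[OF Q] sgn_mult_abs)
next
  case (Suc k)
  have "sgn \<alpha> * newton_sqrt \<bar>\<alpha>\<bar> (d i) k \<noteq> 0" for i
    using newton_sqrt_pos[of "\<bar>\<alpha>\<bar>" "d i" k] d \<open>\<alpha> \<noteq> 0\<close> by (simp add: sgn_0_0)
  then show ?case
    using \<open>\<alpha> \<noteq> 0\<close>
    by (simp add: Suc matrix_inv_orth_conj[OF Q] orth_conj_mult[OF Q] orth_conj_add
        orth_conj_scaleR) (rule arg_cong[of _ _ "orth_conj Q"], auto simp: sgn_if field_simps)
qed

theorem corollary4p2:
  fixes A X0 :: "real^'n^'n" and lam :: "nat \<Rightarrow> real" and \<alpha> t0 \<gamma> :: real
  assumes "transpose A = A"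
    and "sorted_eigenvalues A lam"
    and "0 \<le> lam 1"
    and "\<bar>\<alpha>\<bar> \<ge> sqrt ((lam 1 + lam CARD('n)) / 2)"
    and "sqrt ((lam 1 + lam CARD('n)) / 2) > 0"
    and "X0 = \<alpha> *\<^sub>R mat 1"
    and "t0 = 1/2 * spectral_norm (matrix_inv X0 ** A - X0)"
    and "\<gamma> = sqrt (sigma_min X0) * sqrt (sigma_min X0 - 2 * t0)"
  shows "invertible X0 \<and> X0 ** A = A ** X0
    \<and> sigma_min X0 \<ge> spectral_norm (matrix_inv X0 ** A - X0)
    \<and> spectral_norm (matrix_inv X0 ** A - X0) = 2 * t0
    \<and> (\<forall>k. invertible (newton_iterate A X0 k))
    \<and> (\<exists>Xstar. newton_iterate A X0 \<longlonglongrightarrow> Xstar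
          \<and> (\<alpha> > 0 \<longrightarrow> Xstar = principal_sqrt A)
          \<and> (\<alpha> < 0 \<longrightarrow> Xstar = - principal_sqrt A)
          \<and> (\<forall>k. spectral_norm (Xstar - newton_iterate A X0 k)
                   = sigma_fun \<gamma> ((omega_fun \<gamma> ^^ k) t0)))"
proof -
  define n where "n = CARD('n)"
  define a where "a = \<bar>\<alpha>\<bar>"
  have a: "a > 0" and \<alpha>: "\<alpha> \<noteq> 0" using assms(4,5) by (auto simp: a_def)
  obtain Q d where Q: "orthogonal_matrix Q" and A: "A = orth_conj Q d"
    using symmetric_matrix_diagonalizable[OF assms(1)] .
  have range: "range d = lam ` {1..n}"
    using range_eq_sorted_eigenvalues[OF Q] assms(2) unfolding A n_def by blast
  have n: "1 \<le> n" by (simp add: n_def Suc_leI)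
  have mono: "lam i \<le> lam j" if "1 \<le> i" "i \<le> j" "j \<le> n" for i j
    using assms(2) that by (auto simp: sorted_eigenvalues_def n_def mono_on_def)
  have d_bounds: "lam 1 \<le> d i" "d i \<le> lam n" for i
  proof -
    have "d i \<in> lam ` {1..n}" using range by blast
    then show "lam 1 \<le> d i" "d i \<le> lam n" using mono n by auto
  qed
  have d0: "0 \<le> d i" for i using d_bounds(1)[of i] assms(3) by simp
  obtain j where j: "d j = lam 1"
    using range n by (metis atLeastAtMost_iff image_iff order_refl rangeE)
  have a_sq: "(lam 1 + lam n) / 2 \<le> a\<^sup>2"
    using assms(4) unfolding a_def n_def by (metis power2_abs real_sqrt_le_iff real_sqrt_abs)
  have X0: "X0 = orth_conj Q (\<lambda>i. \<alpha>)"
    using assms(6) orth_conj_const[OF Q] by simp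
  have sig: "sigma_min X0 = a"
    by (simp add: assms(6) sigma_min_scaleR_mat1 a_def)
  have "matrix_inv X0 ** A - X0 = orth_conj Q (\<lambda>i. 1 / \<alpha> * d i - \<alpha>)"
    unfolding X0 A using \<alpha>
    by (simp add: matrix_inv_orth_conj[OF Q] orth_conj_mult[OF Q] orth_conj_diff)
  \<comment> \<open>As \<open>a\<^sup>2\<close> is at least the midpoint of \<open>lam 1\<close> and \<open>lam n\<close>, the eigenvalue farthest from \<open>a\<^sup>2\<close> is \<open>lam 1\<close>.\<close>
  moreover have "spectral_norm (orth_conj Q (\<lambda>i. 1 / \<alpha> * d i - \<alpha>)) = (a\<^sup>2 - lam 1) / a"
  proof (rule spectral_norm_orth_conj[OF Q, where j = j])
    have abs_eq: "\<bar>1 / \<alpha> * d i - \<alpha>\<bar> = \<bar>a\<^sup>2 - d i\<bar> / a" for i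
    proof -
      have "1 / \<alpha> * d i - \<alpha> = (d i - a\<^sup>2) / \<alpha>"
        using \<alpha> by (simp add: a_def field_simps power2_eq_square)
      then show ?thesis by (simp add: a_def abs_minus_commute)
    qed
    show "\<bar>1 / \<alpha> * d i - \<alpha>\<bar> \<le> (a\<^sup>2 - lam 1) / a" for i
      unfolding abs_eq using a a_sq d_bounds[of i] by (intro divide_right_mono) auto
    show "\<bar>1 / \<alpha> * d j - \<alpha>\<bar> = (a\<^sup>2 - lam 1) / a"
      using abs_eq[of j] a_sq d_bounds[of j] j by simp
  qed
  ultimately have norm0: "spectral_norm (matrix_inv X0 ** A - X0) = (a\<^sup>2 - lam 1) / a"
    by simp
  have t0: "t0 = (a\<^sup>2 - lam 1) / a / 2" using assms(7) norm0 by simp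
  have "\<gamma> = sqrt (a * (a - 2 * t0))"
    by (simp add: assms(8) sig real_sqrt_mult)
  also have "a * (a - 2 * t0) = lam 1"
    using a by (simp add: t0 field_simps power2_eq_square)
  finally have \<gamma>: "\<gamma> = sqrt (lam 1)" .
  then have \<gamma>_sq: "\<gamma>\<^sup>2 = lam 1" using assms(3) by simp
  have t0': "t0 = (a - \<gamma>\<^sup>2 / a) / 2"
    using a unfolding t0 \<gamma>_sq by (simp add: diff_divide_distrib power2_eq_square)
  define X where "X k = orth_conj Q (\<lambda>i. sgn \<alpha> * newton_sqrt a (d i) k)" for k
  have iter: "newton_iterate A X0 k = X k" for k
    unfolding assms(6) A X_def a_def by (rule newton_iterate_orth_conj[OF Q d0 \<alpha>])
  define Xstar where "Xstar = orth_conj Q (\<lambda>i. sgn \<alpha> * sqrt (d i))"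
  have lim: "newton_iterate A X0 \<longlonglongrightarrow> Xstar"
    unfolding iter X_def Xstar_def
    by (intro tendsto_orth_conj tendsto_mult_left newton_sqrt_tendsto a d0)
  have err: "spectral_norm (Xstar - newton_iterate A X0 k) = sigma_fun \<gamma> ((omega_fun \<gamma> ^^ k) t0)"
    for k
  proof -
    have "spectral_norm (Xstar - X k) = newton_sqrt a (lam 1) k - sqrt (lam 1)"
      unfolding X_def Xstar_def orth_conj_diff
    proof (rule spectral_norm_orth_conj[OF Q, where j = j])
      have abs_eq: "\<bar>sgn \<alpha> * sqrt (d i) - sgn \<alpha> * newton_sqrt a (d i) k\<bar>
          = \<bar>newton_sqrt a (d i) k - sqrt (d i)\<bar>" for i
        using \<alpha> by (auto simp: sgn_if)
      have start: "\<bar>sqrt (d i) - a\<bar> \<le> a - sqrt (lam 1)" for i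
      proof -
        \<comment> \<open>The mean of the two square roots is at most their root mean square.\<close>
        have "((sqrt (lam 1) + sqrt (lam n)) / 2)\<^sup>2 \<le> (lam 1 + lam n) / 2"
          using zero_le_power2[of "sqrt (lam 1) - sqrt (lam n)"] assms(3) mono[of 1 n] n
          by (simp add: power2_eq_square field_simps)
        then have "((sqrt (lam 1) + sqrt (lam n)) / 2)\<^sup>2 \<le> a\<^sup>2" using a_sq by linarith
        then have "(sqrt (lam 1) + sqrt (lam n)) / 2 \<le> a"
          by (rule power2_le_imp_le) (use a in simp)
        moreover have "\<bar>s - a\<bar> \<le> a - r" if "(r + q) / 2 \<le> a" "r \<le> s" "s \<le> q" for r s q
          using that by (simp add: abs_le_iff field_simps)
        ultimately show ?thesis
          using d_bounds[of i] by simp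
      qed
      have bound: "\<bar>newton_sqrt a (d i) k - sqrt (d i)\<bar> \<le> newton_sqrt a (lam 1) k - sqrt (lam 1)"
        for i
        by (rule newton_sqrt_error_mono[OF a assms(3) d_bounds(1) start])
      then show "\<bar>sgn \<alpha> * sqrt (d i) - sgn \<alpha> * newton_sqrt a (d i) k\<bar>
          \<le> newton_sqrt a (lam 1) k - sqrt (lam 1)" for i
        unfolding abs_eq .
      show "\<bar>sgn \<alpha> * sqrt (d j) - sgn \<alpha> * newton_sqrt a (d j) k\<bar>
          = newton_sqrt a (lam 1) k - sqrt (lam 1)"
        unfolding abs_eq using bound[of j] by (simp add: j)
    qed
    also have "\<dots> = sigma_fun \<gamma> ((omega_fun \<gamma> ^^ k) t0)"
      unfolding t0' omega_fun_iterate_newton_sqrt[OF a]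
        sigma_fun_half_diff[OF newton_sqrt_pos[OF a zero_le_power2]]
      by (simp only: \<gamma>_sq \<gamma>[symmetric])
    finally show ?thesis by (simp add: iter)
  qed
  have "invertible (newton_iterate A X0 k)" for k
    unfolding iter X_def
    by (rule invertible_orth_conj[OF Q])
      (use newton_sqrt_pos[OF a d0] \<alpha> in \<open>simp add: sgn_0_0 less_imp_neq[symmetric]\<close>)
  moreover from this[of 0] have "invertible X0" by simp
  moreover have "X0 ** A = A ** X0"
    unfolding X0 A by (simp add: orth_conj_mult[OF Q] mult.commute)
  moreover have "sigma_min X0 \<ge> spectral_norm (matrix_inv X0 ** A - X0)"
    unfolding sig norm0 using a assms(3) by (simp add: field_simps power2_eq_square)
  moreover have "\<alpha> > 0 \<longrightarrow> Xstar = principal_sqrt A"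
    unfolding A principal_sqrt_orth_conj[OF Q d0] by (simp add: Xstar_def)
  moreover have "\<alpha> < 0 \<longrightarrow> Xstar = - principal_sqrt A"
    unfolding A principal_sqrt_orth_conj[OF Q d0]
    using orth_conj_scaleR[of "-1" Q "\<lambda>i. sqrt (d i)"] by (simp add: Xstar_def)
  moreover have "spectral_norm (matrix_inv X0 ** A - X0) = 2 * t0"
    using assms(7) by simp
  ultimately show ?thesis
    using lim err by blast
qed

end
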